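(* Let $(W,S)$ be a Coxeter system with $S$ finite, and consider the generalized numbers game on its Coxeter graph with edge weights $k_{s,s'}=f_{s,s'}\ell_{s,s'}$ and associated diagonal matrix $J$ as defined in the context. Consider play sequences starting from a certain position $p\in\mathbb{R}^{|S|}$ such that $Jp\in\mathbb{R}_+^{|S|}$ (i.e. all coordinates of $Jp$ are positive real numbers). Denote by $\tilde{\mathcal{P}}_p\subset\mathbb{R}^{|S|}$ the set of all positions which can be reached by moves of the generalized numbers game starting with $p$. Then: 1. Two play sequences $s_1s_2\ldots s_q$ and $s'_1s'_2\ldots s'_r$ ($s_i,s'_i\in S$) lead to the same position (i.e., $p^{s_1s_2\ldots s_q}=p^{s'_1s'_2\ldots s'_r}$) if and only if $s_1s_2\cdots s_q=s'_1s'_2\cdots s'_r$ as elements of the Coxeter group $W$. 2. The induced mapping $w\mapsto p^w$ is a bijection $W\to\tilde{\mathcal{P}}_p$. 3. Let $D_R(w)$ denote the right descent set of $w\in W$. Then $D_R(w)=\{s\in S : \text{the } s\text{-coordinate of } Jp^w \text{ is negative}\}$. 4. The play sequence $s_1s_2\ldots s_q$ is pseudo-positive if and only if $s_1s_2\cdots s_q$ is a reduced decomposition.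
   Context: A Coxeter system $(W,S)$ is a group $W$ generated by $S$ with defining relations $s^2=1$ and $(ss')^{m(s,s')}=1$ for $s\neq s'$, with $m(s,s')=m(s',s)\in\{2,3,\dots\}\cup\{\infty\}$ ($\infty$ meaning no relation). In the Coxeter graph $\Gamma$, with vertex set $S$, distinct $s,s'$ are joined by an edge (are neighbors) exactly when $m(s,s')\ge3$. The right descent set of $w$ is $D_R(w)=\{s\in S:\ \mathrm{len}(ws)<\mathrm{len}(w)\}$, where $\mathrm{len}$ is the word length with respect to $S$; a word $s_1\cdots s_q$ is a reduced decomposition if $q$ is the length of the element it represents. Edge weights: fix complex numbers $k_{s,s'}$ such that (1) for any pair of different generators $(s,s')$, $k_{s,s'}k_{s',s}=4\cos^2(\pi/m(s,s'))$ if $m(s,s')\ne\infty$, and $k_{s,s'}k_{s',s}\ge4$ if $m(s,s')=\infty$; (2) for any pair of different generators $(s,s')$, the number $k_{s,s'}$ is decomposed as $k_{s,s'}=f_{s,s'}\ell_{s,s'}$ in such a way that for any two vertices $s,s'$ connected by an edge, $f_{s,s'}\in\mathbb{C}\setminus\{0\}$, $f_{s,s'}f_{s',s}=1$, and $\ell_{s,s'},\ell_{s',s}$ are positive real numbers; (3) for any cycle in $\Gamma$ with consecutive vertices $s_1,\dots,s_t$, $f_{s_1,s_2}f_{s_2,s_3}\cdots f_{s_{t-1},s_t}f_{s_t,s_1}=1$. Vertex weights: choose one vertex of $\Gamma$ as the origin. For $s\in S$ let $wt(s)$ be the weight of a path from the origin to $s$, that is, the product of the numbers $f_{u,v}$ over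 the consecutive directed edges $(u,v)$ of which this path consists (independent of the path by (3); $wt=1$ at the origin). Let $J$ be the diagonal matrix, indexed by $S$, with diagonal entries $wt(s)$. Game: a position is a column vector $p=(p_s)_{s\in S}$. The move (firing) at node $s$ replaces $p_s$ by $-p_s$, adds $k_{s,s'}p_s$ (with the old value $p_s$) to the value at each neighbor $s'$ of $s$, and leaves all other values unchanged. A play sequence is a word $s_1s_2\ldots s_q$ in $S$, meaning that $s_1$ is fired first, then $s_2$, and so on; $p^{s_1\ldots s_q}$ is the position reached from $p$. For $w\in W$, $p^w$ denotes $p^{s_1\ldots s_q}$ for any word $s_1\cdots s_q$ representing $w$ (well defined by item 1). The move at $s$ from a position $p$ is pseudo-positive if $wt(s)p_s$ is a positive real number. A play sequence starting from $p$ is pseudo-positive if each of its moves is pseudo-positive for the position from which it is made. *)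

theory Defs
  imports
    "HOL-Algebra.Generated_Groups"
    "HOL-Analysis.Analysis"
    "HOL-Library.Complex_Order"
    "HOL-Library.Extended_Nat"
    "Graph_Theory.Graph_Theory"
begin

text \<open>
  A letter \<open>(s, True)\<close> stands for the generator \<open>s\<close>, and \<open>(s, False)\<close> for its formal inverse.
  Words modulo \<open>word_equiv S {}\<close> form the free group on \<open>S\<close>; words modulo \<open>word_equiv S R\<close> form
  its quotient by the normal closure of \<open>R\<close>.
\<close>

inductive word_equiv :: "'a set \<Rightarrow> ('a \<times> bool) list set \<Rightarrow> ('a \<times> bool) list \<Rightarrow> ('a \<times> bool) list \<Rightarrow> bool"
  for S R where
  refl: "word_equiv S R u u"
| sym: "word_equiv S R u v \<Longrightarrow> word_equiv S R v u"
| trans: "word_equiv S R u v \<Longrightarrow> word_equiv S R v w \<Longrightarrow> word_equiv S R u w"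
| cancel: "s \<in> S \<Longrightarrow> word_equiv S R (u @ [(s, b), (s, \<not> b)] @ v) (u @ v)"
| relator: "r \<in> R \<Longrightarrow> word_equiv S R (u @ r @ v) (u @ v)"

definition word_value :: "('a, 'b) monoid_scheme \<Rightarrow> 'a list \<Rightarrow> 'a" where
  "word_value W ws = foldr (\<otimes>\<^bsub>W\<^esub>) ws \<one>\<^bsub>W\<^esub>"

definition signed_word_value :: "('a, 'b) monoid_scheme \<Rightarrow> ('a \<times> bool) list \<Rightarrow> 'a" where
  "signed_word_value W u = word_value W (map (\<lambda>(s, b). if b then s else inv\<^bsub>W\<^esub> s) u)"

definition group_presentation ::
    "('a, 'b) monoid_scheme \<Rightarrow> 'a set \<Rightarrow> ('a \<times> bool) list set \<Rightarrow> bool" where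
  "group_presentation W S R \<longleftrightarrow>
     group W \<and> S \<subseteq> carrier W \<and> generate W S = carrier W \<and>
     (\<forall>u \<in> lists (S \<times> UNIV). signed_word_value W u = \<one>\<^bsub>W\<^esub> \<longleftrightarrow> word_equiv S R u [])"

definition coxeter_relators :: "'a set \<Rightarrow> ('a \<Rightarrow> 'a \<Rightarrow> enat) \<Rightarrow> ('a \<times> bool) list set" where
  "coxeter_relators S m =
     {[(s, True), (s, True)] | s. s \<in> S} \<union>
     {concat (replicate n [(s, True), (t, True)]) | s t n.
        s \<in> S \<and> t \<in> S \<and> s \<noteq> t \<and> m s t = enat n}"

definition coxeter_system ::
    "('a, 'b) monoid_scheme \<Rightarrow> 'a set \<Rightarrow> ('a \<Rightarrow> 'a \<Rightarrow> enat) \<Rightarrow> bool" where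
  "coxeter_system W S m \<longleftrightarrow>
     (\<forall>s\<in>S. \<forall>t\<in>S. s \<noteq> t \<longrightarrow> m s t = m t s \<and> 2 \<le> m s t) \<and>
     group_presentation W S (coxeter_relators S m)"

definition word_length :: "('a, 'b) monoid_scheme \<Rightarrow> 'a set \<Rightarrow> 'a \<Rightarrow> nat" where
  "word_length W S w = (LEAST n. \<exists>ws \<in> lists S. word_value W ws = w \<and> length ws = n)"

definition reduced_decomposition :: "('a, 'b) monoid_scheme \<Rightarrow> 'a set \<Rightarrow> 'a list \<Rightarrow> bool" where
  "reduced_decomposition W S ws \<longleftrightarrow>
     ws \<in> lists S \<and> length ws = word_length W S (word_value W ws)"

definition right_descents :: "('a, 'b) monoid_scheme \<Rightarrow> 'a set \<Rightarrow> 'a \<Rightarrow> 'a set" where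
  "right_descents W S w = {s \<in> S. word_length W S (w \<otimes>\<^bsub>W\<^esub> s) < word_length W S w}"

text \<open>As usual in \<^theory>\<open>Graph_Theory.Graph_Theory\<close>, an undirected edge is a pair of opposite arcs.\<close>

definition coxeter_graph :: "'a set \<Rightarrow> ('a \<Rightarrow> 'a \<Rightarrow> enat) \<Rightarrow> ('a, 'a \<times> 'a) pre_digraph" where
  "coxeter_graph S m =
     with_proj \<lparr> pverts = S, parcs = {(s, t). s \<in> S \<and> t \<in> S \<and> s \<noteq> t \<and> 3 \<le> m s t} \<rparr>"

text \<open>
  Inequalities between complex numbers are those of \<^theory>\<open>HOL-Library.Complex_Order\<close>: they
  compare real parts and require equal imaginary parts. So \<open>0 < z\<close> says that \<open>z\<close> is a positive
  real number, \<open>z < 0\<close> that it is a negative one, and \<open>4 \<le> z\<close> that it is real and at least 4.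
\<close>

definition path_weight :: "('a \<Rightarrow> 'a \<Rightarrow> complex) \<Rightarrow> ('a \<times> 'a) awalk \<Rightarrow> complex" where
  "path_weight f es = (\<Prod>(u, v)\<leftarrow>es. f u v)"

text \<open>
  The library's \<open>cycle\<close> has pairwise distinct vertices, but it also counts the closed walk
  along an edge and back. For these the last condition repeats \<open>f s t * f t s = 1\<close>.
\<close>

definition edge_weights ::
    "'a set \<Rightarrow> ('a \<Rightarrow> 'a \<Rightarrow> enat) \<Rightarrow> ('a \<Rightarrow> 'a \<Rightarrow> complex) \<Rightarrow> ('a \<Rightarrow> 'a \<Rightarrow> complex) \<Rightarrow>
     ('a \<Rightarrow> 'a \<Rightarrow> complex) \<Rightarrow> bool" where
  "edge_weights S m k f l \<longleftrightarrow>
     (\<forall>s\<in>S. \<forall>t\<in>S. s \<noteq> t \<longrightarrow>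
        (case m s t of
           enat n \<Rightarrow> k s t * k t s = complex_of_real (4 * (cos (pi / real n))\<^sup>2)
         | \<infinity> \<Rightarrow> 4 \<le> k s t * k t s)) \<and>
     (\<forall>s\<in>S. \<forall>t\<in>S. s \<noteq> t \<longrightarrow> k s t = f s t * l s t) \<and>
     (\<forall>(s, t) \<in> arcs (coxeter_graph S m).
        f s t \<noteq> 0 \<and> f s t * f t s = 1 \<and> 0 < l s t \<and> 0 < l t s) \<and>
     (\<forall>c. pre_digraph.cycle (coxeter_graph S m) c \<longrightarrow> path_weight f c = 1)"

definition vertex_weight ::
    "('a, 'a \<times> 'a) pre_digraph \<Rightarrow> ('a \<Rightarrow> 'a \<Rightarrow> complex) \<Rightarrow> 'a \<Rightarrow> 'a \<Rightarrow> complex" where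
  "vertex_weight \<Gamma> f orig s = path_weight f (SOME es. pre_digraph.apath \<Gamma> orig es s)"

text \<open>\<open>diag_mult wt p\<close> is the product of the diagonal matrix with entries \<open>wt s\<close> and the vector \<open>p\<close>.\<close>

definition diag_mult :: "('a \<Rightarrow> complex) \<Rightarrow> ('a \<Rightarrow> complex) \<Rightarrow> 'a \<Rightarrow> complex" where
  "diag_mult wt p s = wt s * p s"

definition fire ::
    "('a, 'a \<times> 'a) pre_digraph \<Rightarrow> ('a \<Rightarrow> 'a \<Rightarrow> complex) \<Rightarrow> 'a \<Rightarrow> ('a \<Rightarrow> complex) \<Rightarrow> 'a \<Rightarrow> complex" where
  "fire \<Gamma> k s p = (\<lambda>t. if t = s then - p s
                        else if (s, t) \<in> arcs \<Gamma> then p t + k s t * p s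
                        else p t)"

definition play ::
    "('a, 'a \<times> 'a) pre_digraph \<Rightarrow> ('a \<Rightarrow> 'a \<Rightarrow> complex) \<Rightarrow> ('a \<Rightarrow> complex) \<Rightarrow> 'a list \<Rightarrow> 'a \<Rightarrow> complex" where
  "play \<Gamma> k p ws = fold (fire \<Gamma> k) ws p"

definition reachable_positions ::
    "('a, 'a \<times> 'a) pre_digraph \<Rightarrow> ('a \<Rightarrow> 'a \<Rightarrow> complex) \<Rightarrow> ('a \<Rightarrow> complex) \<Rightarrow> ('a \<Rightarrow> complex) set" where
  "reachable_positions \<Gamma> k p = play \<Gamma> k p ` lists (verts \<Gamma>)"

definition position_at ::
    "('a, 'b) monoid_scheme \<Rightarrow> ('a, 'a \<times> 'a) pre_digraph \<Rightarrow> ('a \<Rightarrow> 'a \<Rightarrow> complex) \<Rightarrow>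
     ('a \<Rightarrow> complex) \<Rightarrow> 'a \<Rightarrow> 'a \<Rightarrow> complex" where
  "position_at W \<Gamma> k p w = play \<Gamma> k p (SOME ws. ws \<in> lists (verts \<Gamma>) \<and> word_value W ws = w)"

fun pseudo_positive ::
    "('a, 'a \<times> 'a) pre_digraph \<Rightarrow> ('a \<Rightarrow> 'a \<Rightarrow> complex) \<Rightarrow> ('a \<Rightarrow> complex) \<Rightarrow> ('a \<Rightarrow> complex) \<Rightarrow>
     'a list \<Rightarrow> bool" where
  "pseudo_positive \<Gamma> k wt p [] \<longleftrightarrow> True"
| "pseudo_positive \<Gamma> k wt p (s # ws) \<longleftrightarrow>
     0 < wt s * p s \<and> pseudo_positive \<Gamma> k wt (fire \<Gamma> k s p) ws"

end

theory Submission
  imports Defs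
begin

text \<open>
  Since \<open>p\<close> is real and \<open>J p\<close> is positive, the vertex weights are real, hence so are the \<open>f\<^sub>s\<^sub>t\<close> along
  edges, and \<open>J p\<close> plays an ordinary numbers game with positive real edge weights. The moves satisfy
  the Coxeter relations, so the position depends only on the group element. The key claim is that
  from a positive position, the value at \<open>s\<close> after playing \<open>w\<close> is positive when \<open>w s\<close> is longer than
  \<open>w\<close>. It follows by induction on the length: split \<open>w = v u\<close> with \<open>u\<close> in a dihedral subgroup and \<open>v\<close>
  having positive values at its two generators, and solve the two-node game explicitly by sines
  (or use that its values increase, if \<open>m = \<infinity>\<close>).
  A value is then negative exactly at the right descents, and firing common descents of two elements
  with the same position brings both down to the identity.
\<close>

section \<open>Words in a Coxeter system\<close>

text \<open>As safe rules these turn \<open>ws \<in> lists S\<close> into a bounded quantifier, which no longer matches the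
  premises of conditional rewrite rules about words.\<close>

declare in_listsD [rule del] in_listsI [rule del]

lemma rev_in_lists_iff [simp]: "rev ws \<in> lists S \<longleftrightarrow> ws \<in> lists S"
  by (simp add: in_lists_conv_set)

section \<open>Alternating words in two letters\<close>

fun alternating :: "'a \<Rightarrow> 'a \<Rightarrow> nat \<Rightarrow> 'a list" where
  "alternating s t 0 = []"
| "alternating s t (Suc n) = s # alternating t s n"

lemma length_alternating [simp]: "length (alternating s t n) = n"
  by (induction s t n rule: alternating.induct) auto

lemma alternating_in_lists [simp]:
  "s \<in> S \<Longrightarrow> t \<in> S \<Longrightarrow> alternating s t n \<in> lists S"
  by (induction s t n rule: alternating.induct) auto

lemma alternating_add:
  "alternating s t (n + j) =
     alternating s t n @ (if even n then alternating s t j else alternating t s j)"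
  by (induction s t n rule: alternating.induct) auto

lemma alternating_snoc:
  "alternating s t (Suc n) = alternating s t n @ [if even n then s else t]"
  using alternating_add[of s t n 1] by auto

lemma rev_alternating:
  "rev (alternating s t n) = (if even n then alternating t s n else alternating s t n)"
proof (induction s t n rule: alternating.induct)
  case (2 s t n)
  have "rev (alternating s t (Suc n)) = rev (alternating t s n) @ [s]"
    by simp
  then show ?case
    using 2 by (simp add: alternating_snoc del: alternating.simps(2))
qed simp

lemma concat_replicate_alternating:
  "concat (replicate n [s, t]) = alternating s t (2 * n)"
  by (induction n) auto

section \<open>Word values and the universal property of the presentation\<close>

locale coxeter =
  fixes W :: "('a, 'b) monoid_scheme" (structure) and S :: "'a set" and m :: "'a \<Rightarrow> 'a \<Rightarrow> enat"
  assumes coxeter_system: "coxeter_system W S m"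
begin

sublocale group W
  using coxeter_system by (simp add: coxeter_system_def group_presentation_def)

lemma S_subset: "S \<subseteq> carrier W"
  and generate_S: "generate W S = carrier W"
  and relations: "u \<in> lists (S \<times> UNIV) \<Longrightarrow>
    signed_word_value W u = \<one> \<longleftrightarrow> word_equiv S (coxeter_relators S m) u []"
  using coxeter_system by (auto simp: coxeter_system_def group_presentation_def)

lemma m_sym: "s \<in> S \<Longrightarrow> t \<in> S \<Longrightarrow> s \<noteq> t \<Longrightarrow> m s t = m t s"
  and m_ge_2: "s \<in> S \<Longrightarrow> t \<in> S \<Longrightarrow> s \<noteq> t \<Longrightarrow> 2 \<le> m s t"
  using coxeter_system by (auto simp: coxeter_system_def)

lemma m_enat_ge_2:
  assumes "s \<in> S" "t \<in> S" "s \<noteq> t" "m s t = enat n"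
  shows "2 \<le> n"
  using m_ge_2[OF assms(1-3)] assms(4) by (simp add: numeral_eq_enat)

lemma word_value_closed [simp]: "ws \<in> lists S \<Longrightarrow> word_value W ws \<in> carrier W"
  unfolding word_value_def using S_subset by (induction ws) auto

lemma word_value_Nil [simp]: "word_value W [] = \<one>"
  and word_value_Cons: "word_value W (s # ws) = s \<otimes> word_value W ws"
  by (simp_all add: word_value_def)

lemma word_value_append:
  assumes "us \<in> lists S" "vs \<in> lists S"
  shows "word_value W (us @ vs) = word_value W us \<otimes> word_value W vs"
  using assms(1)
proof (induction us)
  case (Cons s us)
  then show ?case
    using assms(2) S_subset by (auto simp: word_value_Cons m_assoc)
qed (simp add: assms(2))

text \<open>The presentation speaks of signed words. Unsigned words embed as the
  all-\<open>True\<close> ones, and they are the only words used from here on.\<close>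

lemma word_value_eq_one_iff:
  assumes "ws \<in> lists S"
  shows "word_value W ws = \<one> \<longleftrightarrow>
    word_equiv S (coxeter_relators S m) (map (\<lambda>s. (s, True)) ws) []"
proof -
  have "map (\<lambda>s. (s, True)) ws \<in> lists (S \<times> UNIV)"
    using assms by (auto simp: in_lists_conv_set)
  from relations[OF this] show ?thesis
    by (simp add: signed_word_value_def comp_def)
qed

lemma relator_value:
  assumes "ws \<in> lists S" "map (\<lambda>s. (s, True)) ws \<in> coxeter_relators S m"
  shows "word_value W ws = \<one>"
  using word_equiv.relator[OF assms(2), where u="[]" and v="[]"] word_value_eq_one_iff[OF assms(1)]
  by simp

lemma generator_square: "s \<in> S \<Longrightarrow> s \<otimes> s = \<one>"
  using relator_value[of "[s, s]"] S_subset by (auto simp: coxeter_relators_def word_value_Cons)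

lemma word_value_rev: "ws \<in> lists S \<Longrightarrow> word_value W (ws @ rev ws) = \<one>"
proof (induction ws)
  case (Cons s ws)
  then have *: "s \<in> S" "ws \<in> lists S" "ws @ rev ws \<in> lists S" by auto
  then have "word_value W ((ws @ rev ws) @ [s]) = s"
    using Cons.IH S_subset by (subst word_value_append) (auto simp: word_value_Cons)
  then show ?case
    using generator_square * by (simp add: word_value_Cons)
qed simp

lemma word_value_rev_right: "ws \<in> lists S \<Longrightarrow> word_value W (rev ws @ ws) = \<one>"
  using word_value_rev[of "rev ws"] by simp

text \<open>The presentation only decides when a word is trivial. Since generators are involutions,
  reversing a word inverts its value, so equality of values becomes triviality of one word.\<close>

lemma word_value_eq_iff:
  assumes "us \<in> lists S" "vs \<in> lists S"
  shows "word_value W us = word_value W vs \<longleftrightarrow> word_value W (us @ rev vs) = \<one>"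
proof -
  have "word_value W (rev vs) = inv (word_value W vs)"
    using assms word_value_rev_right[of vs]
    by (intro inv_equality[symmetric]) (auto simp: word_value_append)
  moreover have "word_value W (us @ rev vs) = word_value W us \<otimes> word_value W (rev vs)"
    using assms by (intro word_value_append) auto
  ultimately show ?thesis
    using assms word_value_closed[of us] word_value_closed[of vs] inv_solve_right'[of \<one> "word_value W us" "word_value W vs"]
    by auto
qed

text \<open>Inverses of generators cost nothing, as each generator is its own inverse.\<close>

lemma word_value_surj:
  assumes "w \<in> carrier W"
  shows "\<exists>ws\<in>lists S. word_value W ws = w"
proof -
  have "w \<in> generate W S" using assms generate_S by simp
  then show ?thesis
  proof induction
    case one
    show ?case by (intro bexI[of _ "[]"]) auto
  next
    case (incl s)
    then show ?case using S_subset by (intro bexI[of _ "[s]"]) (auto simp: word_value_Cons)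
  next
    case (inv s)
    then have "inv s = s" using generator_square S_subset by (metis inv_equality subsetD)
    then show ?case using inv S_subset by (intro bexI[of _ "[s]"]) (auto simp: word_value_Cons)
  next
    case (eng g h)
    then obtain us vs where "us \<in> lists S" "word_value W us = g" "vs \<in> lists S" "word_value W vs = h"
      by auto
    then show ?case by (intro bexI[of _ "us @ vs"]) (auto simp: word_value_append)
  qed
qed

lemma fold_eq_if_word_value_eq:
  fixes act :: "'a \<Rightarrow> 'x \<Rightarrow> 'x"
  assumes square: "\<And>s x. s \<in> S \<Longrightarrow> act s (act s x) = x"
    and braid: "\<And>s t n x. s \<in> S \<Longrightarrow> t \<in> S \<Longrightarrow> s \<noteq> t \<Longrightarrow> m s t = enat n \<Longrightarrow>
      fold act (alternating s t (2 * n)) x = x"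
    and words: "us \<in> lists S" "vs \<in> lists S" "word_value W us = word_value W vs"
  shows "fold act us x = fold act vs x"
proof -
  have inv: "fold act (map fst u) x = fold act (map fst v) x"
    if "word_equiv S (coxeter_relators S m) u v" for u v x
    using that
  proof (induction arbitrary: x)
    case (cancel s b u v)
    then show ?case by (simp add: square)
  next
    case (relator r u v)
    then have "fold act (map fst r) y = y" for y
      using braid square
      by (auto simp: coxeter_relators_def map_concat simp flip: concat_replicate_alternating)
    then show ?case by simp
  qed auto
  have undo: "fold act (ws @ rev ws) x = x" if "ws \<in> lists S" for ws x
    using that by (induction ws arbitrary: x) (auto simp: square)
  have "word_value W (us @ rev vs) = \<one>"
    using words word_value_eq_iff by blast
  then have "word_equiv S (coxeter_relators S m) (map (\<lambda>s. (s, True)) (us @ rev vs)) []"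
    using words by (subst (asm) word_value_eq_one_iff) auto
  from inv[OF this] have "fold act (us @ rev vs) x = x"
    by (simp add: comp_def)
  then have "fold act vs (fold act (us @ rev vs) x) = fold act vs x"
    by simp
  moreover have "fold act vs (fold act (rev vs) y) = y" for y
    using undo[of "rev vs" y] words by simp
  ultimately show ?thesis by simp
qed

text \<open>The relator of length \<open>2 * n\<close> splits into \<open>alternating s t n\<close>
  and the reversal of \<open>alternating t s n\<close>; moving the second half to the other side
  gives the braid relation.\<close>

lemma alternating_braid:
  assumes "s \<in> S" "t \<in> S" "s \<noteq> t" "m s t = enat n"
  shows "word_value W (alternating s t n) = word_value W (alternating t s n)"
proof -
  have "word_value W (alternating s t (2 * n)) = \<one>"
    using assms
    by (intro relator_value alternating_in_lists)
      (auto simp: coxeter_relators_def map_concat simp flip: concat_replicate_alternating)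
  moreover have "alternating s t (2 * n) = alternating s t n @ rev (alternating t s n)"
    using alternating_add[of s t n n] by (simp add: rev_alternating mult_2)
  ultimately show ?thesis
    using assms by (simp add: word_value_eq_iff)
qed

lemma rev_alternating_braid:
  assumes "s \<in> S" "t \<in> S" "s \<noteq> t" "m s t = enat n"
  shows "word_value W (rev (alternating s t n)) = word_value W (rev (alternating t s n))"
  using alternating_braid[OF assms] by (simp add: rev_alternating)

section \<open>Length, parity and descents\<close>

abbreviation len :: "'a list \<Rightarrow> nat" where
  "len ws \<equiv> word_length W S (word_value W ws)"

lemma len_le: "ws \<in> lists S \<Longrightarrow> len ws \<le> length ws"
  unfolding word_length_def by (rule Least_le) auto

lemma reduced_word_exists:
  assumes "ws \<in> lists S"
  obtains vs where "vs \<in> lists S" "word_value W vs = word_value W ws" "length vs = len ws"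
proof -
  have "\<exists>vs\<in>lists S. word_value W vs = word_value W ws \<and> length vs = len ws"
    unfolding word_length_def using assms
    by (intro LeastI[of "\<lambda>n. \<exists>vs\<in>lists S. word_value W vs = word_value W ws \<and> length vs = n" "length ws"]) auto
  then show ?thesis using that by blast
qed

text \<open>This is the sign character: all relators have even length, so letting every generator
  negate a truth value is an action.\<close>

lemma even_len:
  assumes "ws \<in> lists S"
  shows "even (len ws) \<longleftrightarrow> even (length ws)"
proof -
  obtain vs where vs: "vs \<in> lists S" "word_value W vs = word_value W ws" "length vs = len ws"
    using reduced_word_exists[OF assms] .
  have fold_Not: "fold (\<lambda>_. Not) us b = (if even (length us) then b else \<not> b)" for us :: "'a list" and b
    by (induction us arbitrary: b) auto
  have "fold (\<lambda>_. Not) vs True = fold (\<lambda>_. Not) ws True"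
    using vs assms by (intro fold_eq_if_word_value_eq) (auto simp: fold_Not)
  then show ?thesis using vs by (auto simp: fold_Not split: if_splits)
qed

lemma len_append_le:
  assumes "us \<in> lists S" "vs \<in> lists S"
  shows "len (us @ vs) \<le> len us + length vs"
proof -
  obtain us' where us': "us' \<in> lists S" "word_value W us' = word_value W us" "length us' = len us"
    using reduced_word_exists[OF assms(1)] .
  have "len (us @ vs) = len (us' @ vs)"
    using us' assms by (simp add: word_value_append)
  also have "\<dots> \<le> length (us' @ vs)"
    using us' assms by (intro len_le) auto
  finally show ?thesis using us' by simp
qed

lemma word_value_double:
  assumes "ws \<in> lists S" "s \<in> S"
  shows "word_value W (ws @ [s, s]) = word_value W ws"
  using assms S_subset generator_square[of s]
  by (subst word_value_append) (auto simp: word_value_Cons)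

text \<open>Multiplying by a generator changes the length by at most one, in both directions because
  it can be undone; parity excludes equality.\<close>

lemma len_snoc:
  assumes "ws \<in> lists S" "s \<in> S"
  shows "len (ws @ [s]) = Suc (len ws) \<or> len ws = Suc (len (ws @ [s]))"
proof -
  have "len (ws @ [s]) \<le> Suc (len ws)"
    using len_append_le[of ws "[s]"] assms by simp
  moreover have "len ws \<le> Suc (len (ws @ [s]))"
    using len_append_le[of "ws @ [s]" "[s]"] word_value_double[OF assms] assms by simp
  moreover have "len (ws @ [s]) \<noteq> len ws"
    using even_len[of ws] even_len[of "ws @ [s]"] assms by auto
  ultimately show ?thesis by linarith
qed

lemma len_eq_0_iff:
  assumes "ws \<in> lists S"
  shows "len ws = 0 \<longleftrightarrow> word_value W ws = \<one>"
proof
  assume "len ws = 0"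
  then show "word_value W ws = \<one>"
    using reduced_word_exists[OF assms] by (metis length_0_conv word_value_Nil)
next
  assume "word_value W ws = \<one>"
  then show "len ws = 0" using len_le[of "[]"] by simp
qed

text \<open>The last letter of a reduced word is a descent.\<close>

lemma descent_exists:
  assumes "ws \<in> lists S" "0 < len ws"
  obtains s where "s \<in> S" "len (ws @ [s]) < len ws"
proof -
  obtain vs where vs: "vs \<in> lists S" "word_value W vs = word_value W ws" "length vs = len ws"
    using reduced_word_exists[OF assms(1)] .
  then obtain us s where us: "vs = us @ [s]"
    using assms(2) by (metis length_greater_0_conv rev_exhaust)
  then have "us \<in> lists S" "s \<in> S" using vs by auto
  then have "word_value W (ws @ [s]) = word_value W vs \<otimes> word_value W [s]"
    using assms(1) vs(2) by (subst word_value_append) auto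
  also have "\<dots> = word_value W (us @ [s, s])"
    using \<open>us \<in> lists S\<close> \<open>s \<in> S\<close> word_value_append[of "us @ [s]" "[s]"] by (simp add: us)
  also have "\<dots> = word_value W us"
    using \<open>us \<in> lists S\<close> \<open>s \<in> S\<close> by (rule word_value_double)
  finally have "word_value W (ws @ [s]) = word_value W us" .
  then have "len (ws @ [s]) < len ws"
    using len_le[OF \<open>us \<in> lists S\<close>] vs us by simp
  then show ?thesis using that \<open>s \<in> S\<close> by blast
qed

end

section \<open>Two-generator games\<close>

text \<open>With diagonal entries -2, the sign change at the fired node and the additions at its
  neighbors become one linear formula.\<close>

definition rfire :: "('a \<Rightarrow> 'a \<Rightarrow> real) \<Rightarrow> 'a \<Rightarrow> ('a \<Rightarrow> real) \<Rightarrow> 'a \<Rightarrow> real" where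
  "rfire L s q = (\<lambda>t. q t + L s t * q s)"

text \<open>When \<open>s\<close> and \<open>t\<close> are fired in turn, the entry \<open>j + 1\<close> is the value at the node fired in
  move \<open>j\<close>, and the other node then carries minus the entry \<open>j\<close>.\<close>

fun fired_values :: "real \<Rightarrow> real \<Rightarrow> real \<Rightarrow> real \<Rightarrow> nat \<Rightarrow> real" where
  "fired_values K K' a b 0 = - b"
| "fired_values K K' a b (Suc 0) = a"
| "fired_values K K' a b (Suc (Suc j)) =
     (if even j then K else K') * fired_values K K' a b (Suc j) - fired_values K K' a b j"

text \<open>Parity tells which node is next in turn. The other one was fired last, which only
  negated it; for \<open>n = 0\<close> this fits because entry 0 is \<open>- q t\<close>.\<close>

lemma rfire_alternating:
  assumes "s \<noteq> t" "L s s = -2" "L t t = -2"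
  shows "fold (rfire L) (alternating s t n) q (if even n then s else t) =
      fired_values (L s t) (L t s) (q s) (q t) (Suc n) \<and>
    fold (rfire L) (alternating s t n) q (if even n then t else s) =
      - fired_values (L s t) (L t s) (q s) (q t) n"
proof (induction n)
  case (Suc n)
  then show ?case
    using assms by (auto simp: alternating_snoc rfire_def simp del: alternating.simps(2))
qed simp

text \<open>Conjugating by \<open>diag(1, \<mu>)\<close> makes the two edge weights equal to \<open>\<nu>\<close>.\<close>

lemma fired_values_rescaled:
  fixes a b :: real
  assumes "\<mu> * K = \<nu>" "K' = \<nu> * \<mu>"
  defines "E \<equiv> \<lambda>j. (if even j then \<mu> else 1) * fired_values K K' a b j"
  shows "E (Suc (Suc j)) = \<nu> * E (Suc j) - E j"
  using assms(1) by (auto simp: E_def assms(2) algebra_simps)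

text \<open>Both sides satisfy the recurrence with coefficient \<open>2 * cos \<phi>\<close> and
  agree at the first two indices. The factor \<open>sin \<phi>\<close> avoids a division, and
  \<open>j - 1\<close> is taken in the reals so that index 0 gives
  \<open>sin (- \<phi>)\<close>.\<close>

lemma fired_values_closed_form:
  fixes a b \<phi> :: real
  assumes "\<mu> * K = 2 * cos \<phi>" "K' = 2 * cos \<phi> * \<mu>"
  shows "(if even j then \<mu> else 1) * fired_values K K' a b j * sin \<phi> =
    a * sin (real j * \<phi>) + \<mu> * b * sin ((real j - 1) * \<phi>)"
proof -
  let ?E = "\<lambda>j. (if even j then \<mu> else 1) * fired_values K K' a b j"
  have sin_rec: "2 * cos \<phi> * sin (x + \<phi>) - sin x = sin (x + 2 * \<phi>)" for x
  proof -
    have "x + 2 * \<phi> = (x + \<phi>) + \<phi>" "x = (x + \<phi>) - \<phi>" by auto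
    then have "sin (x + 2 * \<phi>) = sin (x + \<phi>) * cos \<phi> + cos (x + \<phi>) * sin \<phi>"
      "sin x = sin (x + \<phi>) * cos \<phi> - cos (x + \<phi>) * sin \<phi>"
      by (metis sin_add, metis sin_diff)
    then show ?thesis by simp
  qed
  \<comment> \<open>The recurrence has order two, so two consecutive indices are carried through the
    induction.\<close>
  have "?E j * sin \<phi> = a * sin (real j * \<phi>) + \<mu> * b * sin ((real j - 1) * \<phi>) \<and>
    ?E (Suc j) * sin \<phi> = a * sin (real (Suc j) * \<phi>) + \<mu> * b * sin (real j * \<phi>)"
  proof (induction j)
    case (Suc j)
    have "?E (Suc (Suc j)) * sin \<phi> = 2 * cos \<phi> * (?E (Suc j) * sin \<phi>) - ?E j * sin \<phi>"
      using fired_values_rescaled[OF assms, of j a b] by (simp add: algebra_simps)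
    also have "\<dots> = a * (2 * cos \<phi> * sin (real j * \<phi> + \<phi>) - sin (real j * \<phi>))
      + \<mu> * b * (2 * cos \<phi> * sin ((real j - 1) * \<phi> + \<phi>) - sin ((real j - 1) * \<phi>))"
      using Suc by (simp add: algebra_simps)
    also have "\<dots> = a * sin (real j * \<phi> + 2 * \<phi>) + \<mu> * b * sin ((real j - 1) * \<phi> + 2 * \<phi>)"
      by (simp only: sin_rec)
    finally show ?case
      using Suc by (simp add: algebra_simps)
  qed simp
  then show ?thesis by blast
qed

lemma sin_pi_div_pos:
  assumes "0 < j" "j < n"
  shows "0 < sin (real j * (pi / real n))"
proof (rule sin_gt_zero)
  show "real j * (pi / real n) < pi"
    using assms by (simp add: field_simps)
qed (use assms in auto)

text \<open>For \<open>n > 2\<close> the cosine is positive, which forces \<open>K\<close> to be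
  positive, and \<mu> is determined. For \<open>n = 2\<close> the weights and the cosine all vanish,
  so \<mu> = 1 serves.\<close>

lemma dihedral_scaling:
  fixes K K' \<phi> :: real
  assumes "2 \<le> n" "0 \<le> K" "K * K' = 4 * (cos (pi / real n))\<^sup>2" "n = 2 \<Longrightarrow> K = 0 \<and> K' = 0"
  obtains \<mu> where "0 < \<mu>" "\<mu> * K = 2 * cos (pi / real n)" "K' = 2 * cos (pi / real n) * \<mu>"
proof (cases "n = 2")
  case True
  then show ?thesis using that[of 1] assms(4) by simp
next
  case False
  define c where "c = cos (pi / real n)"
  have "0 < c"
    unfolding c_def using False assms(1) by (intro cos_gt_zero) (auto simp: field_simps)
  then have "0 < K" using assms(2,3) by (cases "K = 0") (auto simp: c_def)
  have "K' = 2 * c * (2 * c / K)"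
    using assms(3) \<open>0 < K\<close> by (simp add: c_def[symmetric] field_simps power2_eq_square)
  then show ?thesis
    using that[of "2 * c / K"] \<open>0 < c\<close> \<open>0 < K\<close> by (simp add: c_def)
qed

lemma sin_pi_div_self_pos: "2 \<le> n \<Longrightarrow> 0 < sin (pi / real n)"
  using sin_pi_div_pos[of 1 n] by simp

text \<open>All angles in the closed form lie between 0 and \<pi>, where sine is nonnegative. The
  first summand is positive unless \<open>Suc j = n\<close>, and then the second one is.\<close>

lemma fired_values_pos_finite:
  fixes K K' a b :: real
  assumes weights: "2 \<le> n" "0 \<le> K" "K * K' = 4 * (cos (pi / real n))\<^sup>2" "n = 2 \<Longrightarrow> K = 0 \<and> K' = 0"
    and "0 < a" "0 < b" "j < n"
  shows "0 < fired_values K K' a b (Suc j)"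
proof -
  obtain \<mu> where \<mu>: "0 < \<mu>" "\<mu> * K = 2 * cos (pi / real n)" "K' = 2 * cos (pi / real n) * \<mu>"
    using dihedral_scaling[OF weights] .
  have "0 < a * sin (real (Suc j) * (pi / real n)) + \<mu> * b * sin (real j * (pi / real n))"
  proof (cases "Suc j = n")
    case True
    then have "0 < sin (real j * (pi / real n))"
      using weights(1) by (intro sin_pi_div_pos) auto
    moreover have "sin (real (Suc j) * (pi / real n)) = 0"
      using True by simp
    ultimately show ?thesis using assms \<mu> by simp
  next
    case False
    then have "0 < sin (real (Suc j) * (pi / real n))"
      using assms by (intro sin_pi_div_pos) auto
    moreover have "0 \<le> sin (real j * (pi / real n))"
      using assms sin_pi_div_pos[of j n] by (cases "j = 0") auto
    ultimately show ?thesis using assms \<mu> by (simp add: add_pos_nonneg)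
  qed
  then have "0 < (if even (Suc j) then \<mu> else 1) * fired_values K K' a b (Suc j) * sin (pi / real n)"
    unfolding fired_values_closed_form[OF \<mu>(2,3)] by simp
  then show ?thesis
    using \<mu>(1) sin_pi_div_self_pos[OF weights(1)] by (auto simp: zero_less_mult_iff split: if_splits)
qed

lemma fired_values_pos_infinite:
  fixes K K' a b :: real
  assumes weights: "0 \<le> K" "4 \<le> K * K'" and "0 < a" "0 < b"
  shows "0 < fired_values K K' a b (Suc j)"
proof -
  define \<nu> where "\<nu> = sqrt (K * K')"
  have "sqrt 4 \<le> \<nu>"
    unfolding \<nu>_def using weights by (intro real_sqrt_le_mono)
  then have "2 \<le> \<nu>" by simp
  have "0 < K" using weights by (cases "K = 0") auto
  have "\<nu> * \<nu> = K * K'"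
    unfolding \<nu>_def using weights by simp
  define \<mu> where "\<mu> = \<nu> / K"
  have "0 < \<mu>" and \<mu>: "\<mu> * K = \<nu>" "K' = \<nu> * \<mu>"
    using \<open>0 < K\<close> \<open>2 \<le> \<nu>\<close> \<open>\<nu> * \<nu> = K * K'\<close> by (auto simp: \<mu>_def field_simps)
  let ?E = "\<lambda>j. (if even j then \<mu> else 1) * fired_values K K' a b j"
  \<comment> \<open>With \<nu> at least 2 the increments of the rescaled entries cannot shrink; the
    first two entries are \<open>- \<mu> * b\<close> and \<open>a\<close>.\<close>
  have "?E j < ?E (Suc j) \<and> 0 < ?E (Suc j)" for j
  proof (induction j)
    case 0
    have "0 < \<mu> * b" using assms \<open>0 < \<mu>\<close> by simp
    then show ?case using assms by simp
  next
    case (Suc j)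
    have "2 * ?E (Suc j) \<le> \<nu> * ?E (Suc j)"
      using Suc \<open>2 \<le> \<nu>\<close> by (intro mult_right_mono) auto
    then show ?case
      using fired_values_rescaled[OF \<mu>, of j a b] Suc by linarith
  qed
  then have "0 < ?E (Suc j)" ..
  then show ?thesis using \<open>0 < \<mu>\<close> by (auto simp: zero_less_mult_iff split: if_splits)
qed

text \<open>After \<open>2 * n\<close> steps the angle has made a full turn, so entries 0 and 1
  recur.\<close>

lemma fired_values_period:
  fixes K K' a b :: real
  assumes weights: "2 \<le> n" "0 \<le> K" "K * K' = 4 * (cos (pi / real n))\<^sup>2" "n = 2 \<Longrightarrow> K = 0 \<and> K' = 0"
  shows "fired_values K K' a b (2 * n) = - b" "fired_values K K' a b (Suc (2 * n)) = a"
proof -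
  obtain \<mu> where \<mu>: "0 < \<mu>" "\<mu> * K = 2 * cos (pi / real n)" "K' = 2 * cos (pi / real n) * \<mu>"
    using dihedral_scaling[OF weights] .
  note sin_pos = sin_pi_div_self_pos[OF weights(1)]
  have "(real (2 * n) - 1) * (pi / real n) = 2 * pi - pi / real n"
    "real (Suc (2 * n)) * (pi / real n) = pi / real n + 2 * pi"
    "real (2 * n) * (pi / real n) = 2 * pi"
    using weights(1) by (auto simp: field_simps)
  then have "\<mu> * fired_values K K' a b (2 * n) * sin (pi / real n) = - (\<mu> * b * sin (pi / real n))"
    and Suc: "fired_values K K' a b (Suc (2 * n)) = a"
    using fired_values_closed_form[OF \<mu>(2,3), of "2 * n" a b]
      fired_values_closed_form[OF \<mu>(2,3), of "Suc (2 * n)" a b] sin_pos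
    by (auto simp: sin_diff)
  then have "(\<mu> * sin (pi / real n)) * (fired_values K K' a b (2 * n) + b) = 0"
    by (simp add: algebra_simps)
  then show "fired_values K K' a b (2 * n) = - b"
    using sin_pos \<mu>(1) by simp
  show "fired_values K K' a b (Suc (2 * n)) = a" by (fact Suc)
qed

text \<open>If \<open>K K' \<noteq> 4\<close>, some combination of the values at \<open>r\<close>, \<open>s\<close> and \<open>t\<close> in which \<open>r\<close> has coefficient 1
  is invariant under firing \<open>s\<close> and \<open>t\<close>. So \<open>r\<close> returns to its old value as soon as \<open>s\<close> and \<open>t\<close> do.\<close>

lemma rfire_alternating_period:
  assumes "s \<noteq> t" "L s s = -2" "L t t = -2"
    and weights: "2 \<le> n" "0 \<le> L s t" "L s t * L t s = 4 * (cos (pi / real n))\<^sup>2"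
      "n = 2 \<Longrightarrow> L s t = 0 \<and> L t s = 0"
  shows "fold (rfire L) (alternating s t (2 * n)) q = q"
proof
  fix r
  let ?Q = "fold (rfire L) (alternating s t (2 * n)) q"
  have s: "?Q s = q s" and t: "?Q t = q t"
    using rfire_alternating[of s t L "2 * n" q, OF assms(1-3)] fired_values_period[OF weights] by auto
  define D where "D = 4 - L s t * L t s"
  have "(cos (pi / real n))\<^sup>2 < 1"
  proof -
    have "0 < (sin (pi / real n))\<^sup>2"
      using sin_pi_div_self_pos[OF weights(1)] by simp
    then show ?thesis using sin_cos_squared_add[of "pi / real n"] by linarith
  qed
  then have "D \<noteq> 0" unfolding D_def weights(3) by simp
  \<comment> \<open>Cramer's rule, with determinant \<open>D\<close>, for the two equations saying
    that the combination \<open>I\<close> below is unchanged by firing \<open>s\<close> and by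
    firing \<open>t\<close>.\<close>
  define x y where "x = (2 * L s r + L t r * L s t) / D" and "y = (2 * L t r + L s r * L t s) / D"
  have "L s r - 2 * x + y * L s t = 0" "L t r - 2 * y + x * L t s = 0"
    using \<open>D \<noteq> 0\<close> unfolding x_def y_def by (simp_all add: field_simps) (simp_all add: D_def algebra_simps)
  then have inv: "L s r = 2 * x - y * L s t" "L t r = 2 * y - x * L t s"
    by linarith+
  define I where "I = (\<lambda>p. p r + x * p s + y * p t)"
  have "I (rfire L s p) = I p" "I (rfire L t p) = I p" for p
    using assms(1-3) by (simp_all add: I_def rfire_def inv algebra_simps)
  then have "I (fold (rfire L) ws p) = I p" if "ws \<in> lists {s, t}" for ws p
    using that by (induction ws arbitrary: p) auto
  then have "I ?Q = I q" by auto
  then show "?Q r = q r" by (simp add: I_def s t)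
qed

section \<open>The real numbers game\<close>

text \<open>For \<open>m s t = 2\<close> the product condition only makes one of the two weights
  vanish; \<open>L_two\<close> makes both vanish, so non-neighbors do not interact.\<close>

locale real_game = coxeter W S m
  for W :: "('a, 'b) monoid_scheme" (structure) and S :: "'a set" and m :: "'a \<Rightarrow> 'a \<Rightarrow> enat" +
  fixes L :: "'a \<Rightarrow> 'a \<Rightarrow> real"
  assumes L_diag: "s \<in> S \<Longrightarrow> L s s = -2"
    and L_nonneg: "s \<in> S \<Longrightarrow> t \<in> S \<Longrightarrow> s \<noteq> t \<Longrightarrow> 0 \<le> L s t"
    and L_finite: "s \<in> S \<Longrightarrow> t \<in> S \<Longrightarrow> s \<noteq> t \<Longrightarrow> m s t = enat n \<Longrightarrow>
      L s t * L t s = 4 * (cos (pi / real n))\<^sup>2"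
    and L_infinite: "s \<in> S \<Longrightarrow> t \<in> S \<Longrightarrow> s \<noteq> t \<Longrightarrow> m s t = \<infinity> \<Longrightarrow> 4 \<le> L s t * L t s"
    and L_two: "s \<in> S \<Longrightarrow> t \<in> S \<Longrightarrow> s \<noteq> t \<Longrightarrow> m s t = 2 \<Longrightarrow> L s t = 0"
begin

abbreviation rplay :: "('a \<Rightarrow> real) \<Rightarrow> 'a list \<Rightarrow> 'a \<Rightarrow> real" where
  "rplay q ws \<equiv> fold (rfire L) ws q"

lemma L_two_both:
  assumes "s \<in> S" "t \<in> S" "s \<noteq> t" "m s t = enat n" "n = 2"
  shows "L s t = 0 \<and> L t s = 0"
  using L_two[of s t] L_two[of t s] assms m_sym[of s t] by (simp add: numeral_eq_enat)

lemma rfire_rfire: "s \<in> S \<Longrightarrow> rfire L s (rfire L s q) = q"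
  by (auto simp: rfire_def L_diag)

lemma rplay_eq:
  assumes "us \<in> lists S" "vs \<in> lists S" "word_value W us = word_value W vs"
  shows "rplay q us = rplay q vs"
  using assms
proof (rule fold_eq_if_word_value_eq[rotated 2])
  fix s t n x assume st: "s \<in> S" "t \<in> S" "s \<noteq> t" "m s t = enat n"
  show "fold (rfire L) (alternating s t (2 * n)) x = x"
    using st m_enat_ge_2[OF st] L_two_both[OF st] L_nonneg L_finite L_diag
    by (intro rfire_alternating_period) auto
qed (simp add: rfire_rfire)

lemma rplay_alternating_pos:
  assumes "s \<in> S" "t \<in> S" "s \<noteq> t" "0 < q s" "0 < q t" "enat j < m s t"
  shows "0 < rplay q (alternating s t j) (if even j then s else t)"
proof -
  have "0 < fired_values (L s t) (L t s) (q s) (q t) (Suc j)"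
  proof (cases "m s t")
    case (enat n)
    then show ?thesis
      using assms m_enat_ge_2[of s t n] L_two_both[of s t n] L_nonneg[of s t] L_finite[of s t n]
      by (intro fired_values_pos_finite[of n]) auto
  next
    case infinity
    then show ?thesis
      using assms L_nonneg[of s t] L_infinite[of s t] by (intro fired_values_pos_infinite) auto
  qed
  then show ?thesis
    using rfire_alternating[of s t L j q] assms L_diag by simp
qed

text \<open>Write the element as \<open>v u\<close> with \<open>u\<close> an alternating word in \<open>s\<close> and a right descent \<open>t\<close>,
  ending in \<open>t\<close>, as long as possible with lengths adding up. Then neither \<open>s\<close> nor \<open>t\<close> is a descent
  of \<open>v\<close>, so by induction both carry positive values after \<open>v\<close>; and \<open>u\<close> is shorter than \<open>m s t\<close>,
  since otherwise the braid relation would make \<open>s\<close> a descent.\<close>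

lemma rplay_pos:
  assumes "\<And>s. s \<in> S \<Longrightarrow> 0 < q s"
    and "ws \<in> lists S" "s \<in> S" "len ws < len (ws @ [s])"
  shows "0 < rplay q ws s"
  using assms(2-4)
proof (induction "len ws" arbitrary: ws s rule: less_induct)
  case less
  show ?case
  proof (cases "len ws = 0")
    case True
    then have "rplay q ws = rplay q []"
      using less.prems len_eq_0_iff by (intro rplay_eq) auto
    then show ?thesis using assms(1) less.prems by simp
  next
    case False
    then obtain t where t: "t \<in> S" "len (ws @ [t]) < len ws"
      using descent_exists less.prems by blast
    then have "s \<noteq> t" using less.prems by auto
    \<comment> \<open>The reversed word ends in \<open>t\<close> for every positive
      \<open>j\<close>, so increasing \<open>j\<close> extends it on the left only.\<close>
    define P where "P = (\<lambda>j. \<exists>vs\<in>lists S. word_value W (vs @ rev (alternating t s j)) = word_value W ws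
      \<and> len vs + j = len ws)"
    have "P 1"
      unfolding P_def using t less.prems len_snoc[of ws t] word_value_double[of ws t]
      by (intro bexI[of _ "ws @ [t]"]) auto
    moreover have "\<forall>j. P j \<longrightarrow> j \<le> len ws"
      unfolding P_def by auto
    ultimately obtain j where j: "P j" "\<And>i. P i \<Longrightarrow> i \<le> j"
      using Greatest_le_nat[of P _ "len ws"] GreatestI_nat[of P 1 "len ws"] by blast
    then have "1 \<le> j" using \<open>P 1\<close> by blast
    obtain vs where vs: "vs \<in> lists S" "len vs + j = len ws"
        "word_value W (vs @ rev (alternating t s j)) = word_value W ws"
      using j(1) unfolding P_def by blast
    \<comment> \<open>\<open>x\<close> is the first letter of the dihedral part, \<open>y\<close>
      the other generator.\<close>
    define x y where "x = (if even j then s else t)" and "y = (if even j then t else s)"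
    have xy: "x \<in> S" "y \<in> S" "x \<noteq> y"
      using t less.prems \<open>s \<noteq> t\<close> by (auto simp: x_def y_def)
    have ua: "rev (alternating t s j) = alternating x y j"
      by (simp add: rev_alternating x_def y_def)
    obtain i where i: "j = Suc i" using \<open>1 \<le> j\<close> by (cases j) auto
    \<comment> \<open>Otherwise absorbing the first letter \<open>x\<close> into \<open>vs\<close>
      would make \<open>ws\<close> shorter than it is.\<close>
    have "len vs < len (vs @ [x])"
    proof (rule ccontr)
      assume "\<not> ?thesis"
      then have "len vs = Suc (len (vs @ [x]))"
        using len_snoc[of vs x] vs xy by auto
      moreover have "word_value W ws = word_value W ((vs @ [x]) @ alternating y x i)"
        using vs(3) unfolding ua by (simp add: i)
      then have "len ws \<le> len (vs @ [x]) + i"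
        using len_append_le[of "vs @ [x]" "alternating y x i"] vs xy by simp
      ultimately show False using vs i by simp
    qed
    then have "0 < rplay q vs x"
      using vs xy \<open>1 \<le> j\<close> by (intro less.hyps) auto
    \<comment> \<open>Otherwise \<open>y\<close> could be split off from \<open>vs\<close> and put
      in front of the dihedral part, against the maximality of \<open>j\<close>.\<close>
    have "len vs < len (vs @ [y])"
    proof (rule ccontr)
      assume "\<not> ?thesis"
      then have *: "len vs = Suc (len (vs @ [y]))"
        using len_snoc[of vs y] vs xy by auto
      have "rev (alternating t s (Suc j)) = y # alternating x y j"
        using ua by (simp add: alternating_snoc y_def del: alternating.simps)
      then have "word_value W ((vs @ [y]) @ rev (alternating t s (Suc j)))
          = word_value W (vs @ [y, y]) \<otimes> word_value W (alternating x y j)"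
        using vs xy word_value_append[of "vs @ [y, y]" "alternating x y j"] by simp
      also have "\<dots> = word_value W ws"
        using vs xy word_value_double[of vs y] word_value_append[of vs "alternating x y j"] ua by simp
      finally have "P (Suc j)"
        unfolding P_def using vs xy * by (intro bexI[of _ "vs @ [y]"]) auto
      then show False using j(2) by fastforce
    qed
    then have "0 < rplay q vs y"
      using vs xy \<open>1 \<le> j\<close> by (intro less.hyps) auto
    have "enat j < m t s"
    proof (rule ccontr)
      assume "\<not> ?thesis"
      then obtain n where n: "m t s = enat n" "n \<le> j"
        by (cases "m t s") auto
      then have "2 \<le> n" using m_enat_ge_2[of t s n] t less.prems \<open>s \<noteq> t\<close> by auto
      then obtain k where k: "n = Suc k" by (cases n) auto
      \<comment> \<open>\<open>us\<close> is what precedes the last \<open>n\<close> letters of the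
        dihedral part. The braid relation rewrites those \<open>n\<close> letters into a word ending
        in \<open>s\<close>.\<close>
      define us where "us = rev (if even n then alternating t s (j - n) else alternating s t (j - n))"
      have us: "us \<in> lists S" "length us = j - n"
        using t less.prems by (auto simp: us_def)
      have "rev (alternating t s j) = us @ rev (alternating t s n)"
        using alternating_add[of t s n "j - n"] n by (simp add: us_def)
      then have "word_value W ws = word_value W (vs @ us) \<otimes> word_value W (rev (alternating t s n))"
        using vs us t less.prems word_value_append[of "vs @ us" "rev (alternating t s n)"]
        by (simp add: rev_alternating)
      also have "\<dots> = word_value W (vs @ us) \<otimes> word_value W (rev (alternating s t n))"
        using rev_alternating_braid[of t s n] n t less.prems \<open>s \<noteq> t\<close> by simp
      also have "\<dots> = word_value W (vs @ us @ rev (alternating t s k) @ [s])"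
        using vs us t less.prems word_value_append[of "vs @ us" "rev (alternating t s k) @ [s]"]
        by (simp add: k rev_alternating)
      finally have "word_value W (ws @ [s]) = word_value W ((vs @ us @ rev (alternating t s k)) @ [s, s])"
        using vs us t less.prems
          word_value_append[of "vs @ us @ rev (alternating t s k) @ [s]" "[s]"] word_value_append[of ws "[s]"]
        by (simp add: rev_alternating)
      also have "\<dots> = word_value W (vs @ us @ rev (alternating t s k))"
        using vs us t less.prems by (intro word_value_double) (auto simp: rev_alternating)
      finally have "len (ws @ [s]) \<le> len vs + (length us + k)"
        using len_append_le[of vs "us @ rev (alternating t s k)"] vs us t less.prems
        by simp
      then show False using less.prems vs us n k by simp
    qed
    then have "enat j < m x y"
      using m_sym[of s t] t less.prems \<open>s \<noteq> t\<close> by (auto simp: x_def y_def)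
    have "rplay q ws = rplay q (vs @ alternating x y j)"
      using vs xy less.prems ua by (intro rplay_eq) auto
    \<comment> \<open>The dihedral part ends in \<open>t\<close>, so \<open>s\<close> is next in
      turn, which is the node where positivity is available.\<close>
    moreover have "(if even j then x else y) = s" by (simp add: x_def y_def)
    ultimately show ?thesis
      using rplay_alternating_pos[of x y "rplay q vs" j] xy \<open>0 < rplay q vs x\<close> \<open>0 < rplay q vs y\<close>
        \<open>enat j < m x y\<close> by simp
  qed
qed

section \<open>Signs, descents and injectivity\<close>

context
  fixes q :: "'a \<Rightarrow> real"
  assumes q_pos: "\<And>s. s \<in> S \<Longrightarrow> 0 < q s"
begin

text \<open>If \<open>s\<close> is a descent, it is an ascent of the shortened element, where the
  value is positive; firing \<open>s\<close> then negates it. By \<open>len_snoc\<close> no third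
  case exists.\<close>

lemma rplay_sign:
  assumes "ws \<in> lists S" "s \<in> S"
  shows "0 < rplay q ws s \<longleftrightarrow> len ws < len (ws @ [s])"
    and "rplay q ws s < 0 \<longleftrightarrow> len (ws @ [s]) < len ws"
proof -
  have neg: "rplay q ws s < 0" if "len (ws @ [s]) < len ws"
  proof -
    have "rplay q ws = rplay q ((ws @ [s]) @ [s])"
      using assms word_value_double[of ws s] by (intro rplay_eq) auto
    moreover have "0 < rplay q (ws @ [s]) s"
      using assms that q_pos word_value_double[of ws s] by (intro rplay_pos) auto
    ultimately show ?thesis
      using assms by (simp add: rfire_def L_diag)
  qed
  consider "len ws < len (ws @ [s])" | "len (ws @ [s]) < len ws"
    using len_snoc[OF assms] by linarith
  then have "0 < rplay q ws s \<and> len ws < len (ws @ [s]) \<or> rplay q ws s < 0 \<and> len (ws @ [s]) < len ws"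
    using neg rplay_pos[OF q_pos assms] by cases auto
  then show "0 < rplay q ws s \<longleftrightarrow> len ws < len (ws @ [s])"
    and "rplay q ws s < 0 \<longleftrightarrow> len (ws @ [s]) < len ws"
    by auto
qed

text \<open>Equal values have equal signs, hence equal descents, and firing a common one shortens
  both. At length 0 neither element has a descent, so both are the identity.\<close>

lemma rplay_inj:
  assumes "us \<in> lists S" "vs \<in> lists S" "\<And>s. s \<in> S \<Longrightarrow> rplay q us s = rplay q vs s"
  shows "word_value W us = word_value W vs"
  using assms
proof (induction "len us" arbitrary: us vs rule: less_induct)
  case less
  have desc: "len (us @ [s]) < len us \<longleftrightarrow> len (vs @ [s]) < len vs" if "s \<in> S" for s
    using rplay_sign(2) less.prems that by metis
  show ?case
  proof (cases "len us = 0")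
    case True
    then have "len vs = 0"
      using descent_exists[of vs] desc less.prems by (metis gr0I not_less_zero)
    then show ?thesis using True len_eq_0_iff less.prems by simp
  next
    case False
    then obtain s where s: "s \<in> S" "len (us @ [s]) < len us"
      using descent_exists less.prems by blast
    have "rplay q (us @ [s]) r = rplay q (vs @ [s]) r" if "r \<in> S" for r
      using less.prems(3) that s by (simp add: rfire_def)
    then have "word_value W (us @ [s]) = word_value W (vs @ [s])"
      using s less.prems by (intro less.hyps) auto
    then show ?thesis
      using less.prems s S_subset by (auto simp: word_value_append word_value_Cons)
  qed
qed

text \<open>A word is reduced exactly when every letter lengthens the prefix before it.\<close>

lemma reduced_iff_rplay_pos:
  assumes "ws \<in> lists S"
  shows "len ws = length ws \<longleftrightarrow> (\<forall>i < length ws. 0 < rplay q (take i ws) (ws ! i))"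
  using assms
proof (induction ws rule: rev_induct)
  case (snoc s ws)
  then have ws: "ws \<in> lists S" "s \<in> S" by auto
  have "len (ws @ [s]) = length (ws @ [s]) \<longleftrightarrow> len ws = length ws \<and> len ws < len (ws @ [s])"
    using len_snoc[OF ws] len_le[OF ws(1)] by auto
  then show ?case
    using snoc.IH[OF ws(1)] rplay_sign(1)[OF ws] by (auto simp: less_Suc_eq nth_append)
qed (use len_eq_0_iff[of "[]"] in simp)

end

end

section \<open>Vertex weights\<close>

text \<open>Weights multiply, so a closed walk that is not a cycle can be split at a repeated vertex
  into two shorter closed walks. Its first arc is set aside because the base vertex is always
  repeated.\<close>

lemma closed_awalk_weight:
  fixes G :: "('a, 'a \<times> 'a) pre_digraph"
  assumes "wf_digraph G" and cycles: "\<And>c. pre_digraph.cycle G c \<Longrightarrow> path_weight f c = 1"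
    and "pre_digraph.awalk G u c u"
  shows "path_weight f c = 1"
  using assms(3)
proof (induction "length c" arbitrary: u c rule: less_induct)
  case less
  interpret wf_digraph G by fact
  show ?case
  proof (cases c)
    case Nil
    then show ?thesis by (simp add: path_weight_def)
  next
    case (Cons e es)
    then have es: "awalk (head G e) es u" "e \<in> arcs G" "u = tail G e"
      using less.prems by (auto simp: awalk_Cons_iff)
    show ?thesis
    proof (cases "distinct (awalk_verts (head G e) es)")
      case True
      then have "cycle c"
        using less.prems Cons by (auto simp: cycle_def)
      then show ?thesis by (rule cycles)
    next
      case False
      then obtain q r s v where d: "es = q @ r @ s" "awalk (head G e) q v" "awalk v r v" "awalk v s u"
          "closed_w r"
        using awalk_cyc_decompE'[OF es(1)] by metis
      then have "r \<noteq> []" by (auto simp: closed_w_def)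
      have "awalk u (e # q @ s) u"
        using d es by (auto simp: awalk_Cons_iff)
      then have "path_weight f (e # q @ s) = 1"
        using \<open>r \<noteq> []\<close> Cons d by (intro less.hyps) auto
      moreover have "path_weight f r = 1"
        using Cons d by (intro less.hyps[of r v]) auto
      ultimately show ?thesis
        using Cons d by (simp add: path_weight_def mult.left_commute)
    qed
  qed
qed

lemma coxeter_graph_simps [simp]:
  "verts (coxeter_graph S m) = S"
  "(s, t) \<in> arcs (coxeter_graph S m) \<longleftrightarrow> s \<in> S \<and> t \<in> S \<and> s \<noteq> t \<and> 3 \<le> m s t"
  "tail (coxeter_graph S m) = fst"
  "head (coxeter_graph S m) = snd"
  by (simp_all add: coxeter_graph_def)

lemma wf_digraph_coxeter_graph: "wf_digraph (coxeter_graph S m)"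
  by unfold_locales auto

text \<open>The chosen path to \<open>s\<close>, prolonged by the arc, and the chosen path to
  \<open>t\<close> are closed up by the same return walk. Both closed walks have weight 1, and the
  nonzero weight of the return walk cancels.\<close>

lemma (in coxeter) vertex_weight_arc:
  assumes connected: "Digraph_Component.connected (coxeter_graph S m)"
    and cycles: "\<And>c. pre_digraph.cycle (coxeter_graph S m) c \<Longrightarrow> path_weight f c = 1"
    and "orig \<in> S" and arc: "(s, t) \<in> arcs (coxeter_graph S m)"
  shows "vertex_weight (coxeter_graph S m) f orig t = vertex_weight (coxeter_graph S m) f orig s * f s t"
proof -
  interpret G: wf_digraph "coxeter_graph S m" by (rule wf_digraph_coxeter_graph)
  have "arcs_ends (coxeter_graph S m) = arcs (coxeter_graph S m)"
    by (simp add: coxeter_graph_def)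
  \<comment> \<open>Connectedness concerns the symmetrized graph; as arcs come in opposite pairs, it
    yields directed walks.\<close>
  then have sym: "symmetric (coxeter_graph S m)"
    using m_sym by (auto simp: symmetric_def intro!: symI)
  have reach: "u \<rightarrow>\<^sup>*\<^bsub>coxeter_graph S m\<^esub> v" if "u \<in> S" "v \<in> S" for u v
    using connected that G.reachable_mk_symmetric_eq[OF sym]
    by (auto simp: Digraph_Component.connected_def strongly_connected_def)
  have weight: "\<exists>es. G.awalk orig es u \<and> vertex_weight (coxeter_graph S m) f orig u = path_weight f es"
    if "u \<in> S" for u
  proof -
    have "\<exists>es. G.apath orig es u"
      using reach[OF \<open>orig \<in> S\<close> that] G.reachable_apath by blast
    then have "G.apath orig (SOME es. G.apath orig es u) u"
      by (rule someI_ex)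
    then show ?thesis
      unfolding vertex_weight_def using G.awalkI_apath by blast
  qed
  obtain P where P: "G.awalk orig P s" "vertex_weight (coxeter_graph S m) f orig s = path_weight f P"
    using weight[of s] arc by auto
  obtain Q where Q: "G.awalk orig Q t" "vertex_weight (coxeter_graph S m) f orig t = path_weight f Q"
    using weight[of t] arc by auto
  obtain R where R: "G.awalk t R orig"
    using reach[of t orig] arc \<open>orig \<in> S\<close> G.reachable_awalk by auto
  note closed = closed_awalk_weight[OF wf_digraph_coxeter_graph cycles]
  have "G.awalk orig (Q @ R) orig" "G.awalk orig (P @ (s, t) # R) orig"
    using P Q R arc by (auto simp: G.awalk_Cons_iff)
  then have "path_weight f (Q @ R) = 1" "path_weight f (P @ (s, t) # R) = 1"
    using closed by blast+
  then have "path_weight f Q * path_weight f R = 1" "path_weight f P * f s t * path_weight f R = 1"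
    by (simp_all add: path_weight_def mult.assoc)
  then have "path_weight f Q * path_weight f R = (path_weight f P * f s t) * path_weight f R"
    "path_weight f R \<noteq> 0" by auto
  then show ?thesis
    unfolding P Q by simp
qed

section \<open>Transfer from the complex game to the real game\<close>

lemma pos_complex_iff: "0 < z \<longleftrightarrow> z \<in> \<real> \<and> 0 < Re z" for z :: complex
  by (auto simp: less_complex_def complex_is_Real_iff)

theorem theorem3p4:
  fixes W :: "('a, 'b) monoid_scheme" and S :: "'a set" and m :: "'a \<Rightarrow> 'a \<Rightarrow> enat"
    and k f l :: "'a \<Rightarrow> 'a \<Rightarrow> complex" and orig :: 'a and p :: "'a \<Rightarrow> complex"
  defines "\<Gamma> \<equiv> coxeter_graph S m"
  defines "wt \<equiv> vertex_weight \<Gamma> f orig"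
  assumes "coxeter_system W S m" and "finite S"
    and "Digraph_Component.connected \<Gamma>"
    and "edge_weights S m k f l"
    and "orig \<in> S"
    and "p \<in> S \<rightarrow>\<^sub>E \<real>"
    and "\<forall>s\<in>S. 0 < diag_mult wt p s"
  shows "(reachable_positions \<Gamma> k p \<subseteq> S \<rightarrow>\<^sub>E \<real>) \<and>
    (\<forall>ws \<in> lists S. \<forall>ws' \<in> lists S.
           play \<Gamma> k p ws = play \<Gamma> k p ws' \<longleftrightarrow> word_value W ws = word_value W ws') \<and>
    (bij_betw (position_at W \<Gamma> k p) (carrier W) (reachable_positions \<Gamma> k p)) \<and>
    (\<forall>w \<in> carrier W. right_descents W S w = {s \<in> S. diag_mult wt (position_at W \<Gamma> k p w) s < 0}) \<and>
    (\<forall>ws \<in> lists S. pseudo_positive \<Gamma> k wt p ws \<longleftrightarrow> reduced_decomposition W S ws)"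
proof -
  interpret coxeter W S m by unfold_locales fact
  have ew: "\<And>s t. s \<in> S \<Longrightarrow> t \<in> S \<Longrightarrow> s \<noteq> t \<Longrightarrow>
        (case m s t of
           enat n \<Rightarrow> k s t * k t s = complex_of_real (4 * (cos (pi / real n))\<^sup>2)
         | \<infinity> \<Rightarrow> 4 \<le> k s t * k t s)"
    "\<And>s t. s \<in> S \<Longrightarrow> t \<in> S \<Longrightarrow> s \<noteq> t \<Longrightarrow> k s t = f s t * l s t"
    "\<And>s t. (s, t) \<in> arcs \<Gamma> \<Longrightarrow> f s t \<noteq> 0 \<and> 0 < l s t"
    "\<And>c. pre_digraph.cycle \<Gamma> c \<Longrightarrow> path_weight f c = 1"
    using \<open>edge_weights S m k f l\<close> by (auto simp: edge_weights_def \<Gamma>_def)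
  define \<omega> where "\<omega> = (\<lambda>s. Re (wt s))"
  have wt: "wt s = of_real (\<omega> s)" "\<omega> s \<noteq> 0" if "s \<in> S" for s
  proof -
    have "0 < wt s * p s" "p s \<in> \<real>"
      using assms that by (auto simp: diag_mult_def)
    then have "p s \<noteq> 0" "wt s * p s \<in> \<real>" "wt s \<noteq> 0"
      by (auto simp: pos_complex_iff)
    then have "wt s * p s / p s \<in> \<real>"
      using \<open>p s \<in> \<real>\<close> by (intro Reals_divide)
    then have "wt s \<in> \<real>"
      using \<open>p s \<noteq> 0\<close> by simp
    then show "wt s = of_real (\<omega> s)" by (simp add: \<omega>_def)
    then show "\<omega> s \<noteq> 0" using \<open>wt s \<noteq> 0\<close> by auto
  qed
  define \<kappa> where "\<kappa> = (\<lambda>s t. Re (k s t))"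
  have arc: "k s t = of_real (\<kappa> s t) \<and> 0 < \<omega> t / \<omega> s * \<kappa> s t" if "(s, t) \<in> arcs \<Gamma>" for s t
  proof -
    have st: "s \<in> S" "t \<in> S" "s \<noteq> t" using that by (auto simp: \<Gamma>_def)
    have "wt t = wt s * f s t"
      unfolding wt_def \<Gamma>_def using assms(5,7) that ew(4)
      by (intro vertex_weight_arc) (auto simp: \<Gamma>_def)
    then have f: "f s t = of_real (\<omega> t / \<omega> s)"
      using wt st by (simp add: field_simps)
    define \<nu> where "\<nu> = Re (l s t)"
    have l: "l s t = of_real \<nu>" "0 < \<nu>"
      using ew(3)[OF that] by (auto simp: pos_complex_iff \<nu>_def)
    have "k s t = of_real (\<omega> t / \<omega> s * \<nu>)"
      using ew(2)[OF st] f l by simp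
    then have "\<kappa> s t = \<omega> t / \<omega> s * \<nu>" "k s t = of_real (\<kappa> s t)"
      by (simp_all add: \<kappa>_def)
    moreover have "0 < (\<omega> t / \<omega> s)\<^sup>2 * \<nu>"
      using wt st l by simp
    ultimately show ?thesis by (simp add: power2_eq_square)
  qed
  have not_arc: "m s t = 2" if "s \<in> S" "t \<in> S" "s \<noteq> t" "(s, t) \<notin> arcs \<Gamma>" for s t
    using m_ge_2[of s t] that by (cases "m s t") (auto simp: \<Gamma>_def numeral_eq_enat)
  have arc_sym: "(t, s) \<in> arcs \<Gamma>" if "(s, t) \<in> arcs \<Gamma>" for s t
    using that m_sym by (auto simp: \<Gamma>_def)
  text \<open>As \<open>wt t = wt s * f s t\<close>, the edge weights of the game played by \<open>J p\<close> are \<open>(f s t)\<^sup>2 * l s t\<close>,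
    not \<open>l s t\<close>. They are positive because \<open>f s t\<close> is real.\<close>
  define L where "L = (\<lambda>s t. if s = t then -2 else if (s, t) \<in> arcs \<Gamma> then \<omega> t / \<omega> s * \<kappa> s t else 0)"
  \<comment> \<open>The ratios of vertex weights for the two directions are inverse to each other,
    so the conditions on products carry over to \<open>L\<close>.\<close>
  have L_prod: "complex_of_real (L s t * L t s) = k s t * k t s" if "(s, t) \<in> arcs \<Gamma>" for s t
  proof -
    have "s \<in> S" "t \<in> S" "s \<noteq> t" using that by (auto simp: \<Gamma>_def)
    then have "L s t * L t s = \<kappa> s t * \<kappa> t s"
      using that arc_sym[OF that] wt by (simp add: L_def)
    then show ?thesis
      using arc[OF that] arc[OF arc_sym[OF that]] by simp
  qed
  interpret real_game W S m L
  proof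
    fix s t assume st: "s \<in> S" "t \<in> S" "s \<noteq> t"
    show "0 \<le> L s t"
      using arc[of s t] st by (auto simp: L_def less_imp_le)
    show "L s t * L t s = 4 * (cos (pi / real n))\<^sup>2" if n: "m s t = enat n" for n
    proof (cases "(s, t) \<in> arcs \<Gamma>")
      case True
      then have "complex_of_real (L s t * L t s) = complex_of_real (4 * (cos (pi / real n))\<^sup>2)"
        using ew(1)[OF st] n L_prod[OF True] by simp
      then show ?thesis by (simp only: of_real_eq_iff)
    next
      case False
      then have "n = 2" using not_arc[of s t] st n by (simp add: numeral_eq_enat)
      then show ?thesis using False st by (simp add: L_def)
    qed
    show "4 \<le> L s t * L t s" if "m s t = \<infinity>"
    proof -
      have "(s, t) \<in> arcs \<Gamma>" using st that by (simp add: \<Gamma>_def)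
      then have "4 \<le> complex_of_real (L s t * L t s)"
        using ew(1)[OF st] that L_prod[of s t] by simp
      then show ?thesis by (simp add: less_eq_complex_def)
    qed
    show "L s t = 0" if "m s t = 2"
      using st that by (simp add: L_def \<Gamma>_def)
  qed (simp add: L_def)

  \<comment> \<open>\<open>R x\<close> is \<open>J x\<close> as a real vector. Its value 0 outside
    \<open>S\<close> agrees with \<open>L s t = 0\<close> there, so \<open>R\<close> intertwines the
    two kinds of firing at every index.\<close>
  define R where "R = (\<lambda>x t. if t \<in> S then \<omega> t * Re (x t) else 0)"
  have diag: "diag_mult wt x s = of_real (R x s)" if "x \<in> S \<rightarrow>\<^sub>E \<real>" "s \<in> S" for x s
    using wt(1)[OF that(2)] PiE_mem[OF that] that(2) by (simp add: diag_mult_def R_def)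
  have fire: "fire \<Gamma> k s x \<in> S \<rightarrow>\<^sub>E \<real>" "R (fire \<Gamma> k s x) = rfire L s (R x)"
    if x: "x \<in> S \<rightarrow>\<^sub>E \<real>" and s: "s \<in> S" for x s
  proof -
    show "fire \<Gamma> k s x \<in> S \<rightarrow>\<^sub>E \<real>"
      using x s arc by (auto simp: fire_def PiE_iff extensional_def \<Gamma>_def)
    show "R (fire \<Gamma> k s x) = rfire L s (R x)"
    proof
      fix t
      consider "t \<notin> S" | "t = s" | "(s, t) \<in> arcs \<Gamma>" | "t \<in> S" "t \<noteq> s" "(s, t) \<notin> arcs \<Gamma>"
        by blast
      then show "R (fire \<Gamma> k s x) t = rfire L s (R x) t"
      proof cases
        case 3
        then have st: "s \<in> S" "t \<in> S" "s \<noteq> t" by (auto simp: \<Gamma>_def)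
        have "k s t = of_real (\<kappa> s t)"
          using arc[OF 3] by blast
        then have "Re (k s t * x s) = \<kappa> s t * Re (x s)"
          by simp
        then show ?thesis
          using 3 st wt(2)[OF s] by (simp add: R_def fire_def rfire_def L_def field_simps)
      qed (use s in \<open>auto simp: R_def fire_def rfire_def L_def \<Gamma>_def\<close>)
    qed
  qed
  have play: "play \<Gamma> k x ws \<in> S \<rightarrow>\<^sub>E \<real> \<and> R (play \<Gamma> k x ws) = rplay (R x) ws"
    if "x \<in> S \<rightarrow>\<^sub>E \<real>" "ws \<in> lists S" for x ws
    using that fire by (induction ws arbitrary: x) (auto simp: play_def)
  have R_inj: "x = y" if "x \<in> S \<rightarrow>\<^sub>E \<real>" "y \<in> S \<rightarrow>\<^sub>E \<real>" "R x = R y" for x y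
  proof (rule PiE_ext[OF that(1,2)])
    fix s assume s: "s \<in> S"
    have "R x s = R y s" using that(3) by simp
    then have "Re (x s) = Re (y s)" using s wt(2)[OF s] by (simp add: R_def)
    then show "x s = y s"
      using PiE_mem[OF that(1) s] PiE_mem[OF that(2) s] by (metis of_real_Re)
  qed
  have p: "p \<in> S \<rightarrow>\<^sub>E \<real>" by fact
  have q_pos: "0 < R p s" if "s \<in> S" for s
    using diag[OF p that] bspec[OF assms(9) that] by (simp add: less_complex_def)
  have verts: "verts \<Gamma> = S" by (simp add: \<Gamma>_def)

  have reach: "reachable_positions \<Gamma> k p \<subseteq> S \<rightarrow>\<^sub>E \<real>"
    unfolding reachable_positions_def verts using play[OF p] by auto
  have same: "play \<Gamma> k p us = play \<Gamma> k p vs \<longleftrightarrow> word_value W us = word_value W vs"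
    if "us \<in> lists S" "vs \<in> lists S" for us vs
  proof
    assume "play \<Gamma> k p us = play \<Gamma> k p vs"
    then have "rplay (R p) us = rplay (R p) vs"
      using play[OF p that(1)] play[OF p that(2)] by simp
    then show "word_value W us = word_value W vs"
      using q_pos that by (intro rplay_inj[of "R p"]) auto
  next
    assume "word_value W us = word_value W vs"
    then have "rplay (R p) us = rplay (R p) vs"
      by (rule rplay_eq[OF that])
    then show "play \<Gamma> k p us = play \<Gamma> k p vs"
      using play[OF p that(1)] play[OF p that(2)] by (intro R_inj) simp_all
  qed
  \<comment> \<open>The word chosen by \<open>SOME\<close> may differ from \<open>ws\<close>, but it
    has the same value.\<close>
  have position: "position_at W \<Gamma> k p (word_value W ws) = play \<Gamma> k p ws" if "ws \<in> lists S" for ws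
  proof -
    have "\<exists>us. us \<in> lists S \<and> word_value W us = word_value W ws"
      using that by blast
    from someI_ex[OF this] show ?thesis
      unfolding position_at_def verts by (intro iffD2[OF same] that) simp_all
  qed
  have "inj_on (position_at W \<Gamma> k p) (carrier W)"
  proof (rule inj_onI)
    fix v w assume "v \<in> carrier W" "w \<in> carrier W" and eq: "position_at W \<Gamma> k p v = position_at W \<Gamma> k p w"
    obtain us where us: "us \<in> lists S" "word_value W us = v"
      using word_value_surj[OF \<open>v \<in> carrier W\<close>] by blast
    obtain vs where vs: "vs \<in> lists S" "word_value W vs = w"
      using word_value_surj[OF \<open>w \<in> carrier W\<close>] by blast
    have "play \<Gamma> k p us = play \<Gamma> k p vs"
      using eq position[OF us(1)] position[OF vs(1)] unfolding us(2) vs(2) by (simp only:)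
    then show "v = w"
      using same[OF us(1) vs(1)] unfolding us(2) vs(2) by blast
  qed
  moreover have "position_at W \<Gamma> k p ` carrier W = reachable_positions \<Gamma> k p"
  proof -
    have "carrier W = word_value W ` lists S"
    proof (intro equalityI subsetI)
      show "w \<in> word_value W ` lists S" if "w \<in> carrier W" for w
        using word_value_surj[OF that] by blast
    qed (use word_value_closed in blast)
    then show ?thesis
      unfolding reachable_positions_def verts using position by (simp only: image_image cong: image_cong)
  qed
  ultimately have bij: "bij_betw (position_at W \<Gamma> k p) (carrier W) (reachable_positions \<Gamma> k p)"
    by (simp add: bij_betw_def)
  have descents: "right_descents W S w = {s \<in> S. diag_mult wt (position_at W \<Gamma> k p w) s < 0}"
    if "w \<in> carrier W" for w
  proof -
    obtain ws where ws: "ws \<in> lists S" "w = word_value W ws"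
      using word_value_surj[OF \<open>w \<in> carrier W\<close>] by blast
    have "word_length W S (w \<otimes>\<^bsub>W\<^esub> s) < word_length W S w \<longleftrightarrow>
        diag_mult wt (position_at W \<Gamma> k p w) s < 0" if s: "s \<in> S" for s
    proof -
      have "w \<otimes>\<^bsub>W\<^esub> s = word_value W (ws @ [s])"
        using ws(1) s S_subset unfolding ws(2) by (subst word_value_append) (auto simp: word_value_Cons)
      then have "word_length W S (w \<otimes>\<^bsub>W\<^esub> s) < word_length W S w \<longleftrightarrow> rplay (R p) ws s < 0"
        using rplay_sign(2)[of "R p" ws s, OF q_pos ws(1) s] unfolding ws(2) by simp
      also have "\<dots> \<longleftrightarrow> complex_of_real (rplay (R p) ws s) < 0"
        by (simp add: less_complex_def)
      also have "complex_of_real (rplay (R p) ws s) = diag_mult wt (position_at W \<Gamma> k p w) s"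
        using play[OF p ws(1)] diag[of "play \<Gamma> k p ws" s] s position[OF ws(1)] unfolding ws(2) by simp
      finally show ?thesis .
    qed
    then show ?thesis by (auto simp: right_descents_def)
  qed
  \<comment> \<open>The start \<open>x\<close> is arbitrary because the rest of the word is played
    from the position after the first move.\<close>
  have pseudo: "pseudo_positive \<Gamma> k wt x ws \<longleftrightarrow> (\<forall>i < length ws. 0 < rplay (R x) (take i ws) (ws ! i))"
    if "x \<in> S \<rightarrow>\<^sub>E \<real>" "ws \<in> lists S" for x ws
    using that
  proof (induction ws arbitrary: x)
    case (Cons s ws)
    then have s: "s \<in> S" and ws: "ws \<in> lists S" by auto
    have "0 < wt s * x s \<longleftrightarrow> 0 < R x s"
      using diag[OF Cons.prems(1) s] by (simp add: diag_mult_def less_complex_def)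
    then show ?case
      using Cons.IH[OF fire(1)[OF Cons.prems(1) s] ws] fire(2)[OF Cons.prems(1) s]
      by (simp add: All_less_Suc2)
  qed simp
  have positive: "pseudo_positive \<Gamma> k wt p ws \<longleftrightarrow> reduced_decomposition W S ws" if "ws \<in> lists S" for ws
  proof -
    have "pseudo_positive \<Gamma> k wt p ws \<longleftrightarrow> len ws = length ws"
      unfolding pseudo[OF p that] by (rule reduced_iff_rplay_pos[of "R p", OF q_pos that, symmetric])
    then show ?thesis
      unfolding reduced_decomposition_def using that by metis
  qed
  show ?thesis
    by (intro conjI ballI reach same bij descents positive)
qed

end
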